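(* Let $\{\sigma_i\}_{i\in I}$ be a family of contiguous patterns. In (i) and (ii), for each $i\in I$ let $k_i$ be an integer greater than all letters of $\sigma_i$; in (iii) and (iv), assume that all letters of every $\sigma_i$ are greater than $1$. Let $n\ge 1$ and $\pi\in\mathcal{S}_n$. Write $\pi=\pi_{\ell}\,n\,\pi_r$, where $\pi_\ell$ and $\pi_r$ are the parts of $\pi$ to the left and to the right of the letter $n$, and $\pi=\widehat{\pi}_{\ell}\,1\,\widehat{\pi}_r$, where $\widehat{\pi}_\ell$ and $\widehat{\pi}_r$ are the parts of $\pi$ to the left and to the right of the letter $1$. Then: (i) $\pi$ avoids all the patterns $k_i$-$\sigma_i$ ($i\in I$) if and only if $\pi_\ell$ avoids all the patterns $k_i$-$\sigma_i$ ($i\in I$) and $\pi_r$ avoids all the patterns $\sigma_i$ ($i\in I$). (ii) $\pi$ avoids all the patterns $\sigma_i$-$k_i$ ($i\in I$) if and only if $\pi_\ell$ avoids all the patterns $\sigma_i$ ($i\in I$) and $\pi_r$ avoids all the patterns $\sigma_i$-$k_i$ ($i\in I$). (iii) $\pi$ avoids all the patterns $1$-$\sigma_i$ ($i\in I$) if and only if $\widehat{\pi}_\ell$ avoids all the patterns $1$-$\sigma_i$ ($i\in I$) and $\widehat{\pi}_r$ avoids all the patterns $\sigma_i$ ($i\in I$). (iv) $\pi$ avoids all the patterns $\sigma_i$-$1$ ($i\in I$) if and only if $\widehat{\pi}_\ell$ avoids all the patterns $\sigma_i$ ($i\in I$) and $\widehat{\pi}_r$ avoids all the patterns $\sigma_i$-$1$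 ($i\in I$).
   Context: $\mathcal{S}_n$ is the set of permutations of $[n]=\{1,\dots,n\}$, written as words. A (partially ordered generalized) pattern is a nonempty word $p_1p_2\dots p_m$ of positive integers (repetitions allowed) with a dash written between some of the consecutive letters; it is contiguous if it has no dashes. An occurrence of it in a word $w=a_1\dots a_N$ of distinct integers (in particular in a permutation or a factor of a permutation) is a subsequence $a_{j_1}a_{j_2}\dots a_{j_m}$, $j_1<\dots<j_m$, such that (a) $p_s>p_t$ implies $a_{j_s}>a_{j_t}$ for all $s,t$ (no condition when $p_s=p_t$), and (b) $j_{s+1}=j_s+1$ whenever $p_s$ and $p_{s+1}$ are not separated by a dash. $w$ avoids the pattern if it has no occurrence of it. The notation $k$-$\sigma$ means the letter $k$, then a dash, then $\sigma$; similarly for $\sigma$-$k$. *)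

theory Defs
  imports "HOL-Combinatorics.Multiset_Permutations"
begin

text \<open>
  Positions are counted from 0, so a pattern \<open>p\<^sub>1 \<dots> p\<^sub>m\<close> has its letters at positions
  \<open>0, \<dots>, m - 1\<close>; \<open>s \<in> dashes p\<close> means that a dash is written between the letters at
  positions \<open>s\<close> and \<open>Suc s\<close>.
\<close>

datatype pattern = Pattern (letters: "nat list") (dashes: "nat set")

definition wf_pattern :: "pattern \<Rightarrow> bool" where
  "wf_pattern p \<longleftrightarrow>
     letters p \<noteq> [] \<and> (\<forall>a \<in> set (letters p). 1 \<le> a) \<and>
     dashes p \<subseteq> {s. Suc s < length (letters p)}"

definition contiguous :: "pattern \<Rightarrow> bool" where
  "contiguous p \<longleftrightarrow> dashes p = {}"

text \<open>
  The subsequence of \<open>w\<close> is given by its positions: \<open>j s\<close> is the position in \<open>w\<close> of the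
  letter matched with the letter of \<open>p\<close> at position \<open>s\<close>.  Values of \<open>j\<close> outside
  \<open>{..<length (letters p)}\<close> are irrelevant.
\<close>

definition occurrence :: "pattern \<Rightarrow> nat list \<Rightarrow> (nat \<Rightarrow> nat) \<Rightarrow> bool" where
  "occurrence p w j \<longleftrightarrow>
     (let m = length (letters p) in
        strict_mono_on {..<m} j \<and> (\<forall>s<m. j s < length w) \<and>
        (\<forall>s<m. \<forall>t<m. letters p ! s > letters p ! t \<longrightarrow> w ! j s > w ! j t) \<and>
        (\<forall>s. Suc s < m \<and> s \<notin> dashes p \<longrightarrow> j (Suc s) = j s + 1))"

definition avoids :: "nat list \<Rightarrow> pattern \<Rightarrow> bool" where
  "avoids w p \<longleftrightarrow> \<not> (\<exists>j. occurrence p w j)"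

definition letter_dash :: "nat \<Rightarrow> pattern \<Rightarrow> pattern" where
  "letter_dash k p = Pattern (k # letters p) (insert 0 (Suc ` dashes p))"

text \<open>The last letter of \<open>p\<close> is at position \<open>length (letters p) - 1\<close>; \<open>p\<close> is assumed nonempty.\<close>

definition dash_letter :: "pattern \<Rightarrow> nat \<Rightarrow> pattern" where
  "dash_letter p k = Pattern (letters p @ [k]) (insert (length (letters p) - 1) (dashes p))"

end

theory Submission
  imports Defs
begin

text \<open>
  The letters matched with a contiguous pattern \<open>\<sigma>\<close> form a factor. If that factor contained
  the extremal letter (\<open>n\<close> or \<open>1\<close>), the letter matched with \<open>k\<close> (or \<open>1\<close>) would have to be even
  more extreme. So the factor lies entirely to the left or entirely to the right of the extremal
  letter, and to a factor on its right the extremal letter itself can be prepended.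
  Parts (ii) and (iv) are the mirror images of (i) and (iii).
\<close>

section \<open>Words whose letters respect the order of the pattern letters\<close>

text \<open>The condition quantifies over the set of matched pairs instead of indices, so a letter
  added at either end merely inserts one more pair.\<close>

definition order_match :: "nat list \<Rightarrow> nat list \<Rightarrow> bool" where
  "order_match q u \<longleftrightarrow> length q = length u \<and>
     (\<forall>(a, x) \<in> set (zip q u). \<forall>(b, y) \<in> set (zip q u). b < a \<longrightarrow> y < x)"

lemma order_match_nth:
  "order_match q u \<longleftrightarrow> length q = length u \<and>
     (\<forall>s<length q. \<forall>t<length q. q ! s > q ! t \<longrightarrow> u ! s > u ! t)"
  unfolding order_match_def set_zip by fastforce

lemma ball_snd_zip:
  assumes "length q = length u"
  shows "(\<forall>(a, x)\<in>set (zip q u). P x) \<longleftrightarrow> (\<forall>x\<in>set u. P x)"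
proof -
  have "set u = snd ` set (zip q u)" by (metis assms map_snd_zip set_map)
  thus ?thesis by auto
qed

text \<open>For equal lengths both sides concern the same set of pairs, and otherwise both are
  false. This lets \<sigma>-k reuse the facts about k-\<sigma>.\<close>

lemma order_match_snoc_iff:
  "order_match (q @ [k]) (u @ [c]) \<longleftrightarrow> order_match (k # q) (c # u)"
  by (cases "length q = length u") (auto simp: order_match_def)

lemma order_match_Cons:
  "order_match (k # q) (c # u) \<longleftrightarrow> order_match q u \<and>
     (\<forall>(a, x)\<in>set (zip q u). (a < k \<longrightarrow> x < c) \<and> (k < a \<longrightarrow> c < x))"
  by (auto simp: order_match_def)

text \<open>With every letter of \<open>q\<close> below \<open>k\<close>, each pair
  \<open>(a, x)\<close> demands exactly \<open>x < c\<close>; for equal lengths these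
  \<open>x\<close> run through all of \<open>u\<close>.\<close>

lemma order_match_Cons_greater:
  assumes "\<forall>a\<in>set q. a < k"
  shows "order_match (k # q) (c # u) \<longleftrightarrow> order_match q u \<and> (\<forall>d\<in>set u. d < c)"
proof -
  have eq: "(\<forall>(a, x)\<in>set (zip q u). (a < k \<longrightarrow> x < c) \<and> (k < a \<longrightarrow> c < x)) \<longleftrightarrow>
      (\<forall>(a, x)\<in>set (zip q u). x < c)"
    using assms by (intro ball_cong) (fastforce dest: set_zip_leftD)+
  show ?thesis
  proof (cases "length q = length u")
    case True
    show ?thesis unfolding order_match_Cons eq ball_snd_zip[OF True] ..
  next
    case False
    thus ?thesis by (simp add: order_match_def)
  qed
qed

lemma order_match_Cons_less:
  assumes "\<forall>a\<in>set q. k < a"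
  shows "order_match (k # q) (c # u) \<longleftrightarrow> order_match q u \<and> (\<forall>d\<in>set u. c < d)"
proof -
  have eq: "(\<forall>(a, x)\<in>set (zip q u). (a < k \<longrightarrow> x < c) \<and> (k < a \<longrightarrow> c < x)) \<longleftrightarrow>
      (\<forall>(a, x)\<in>set (zip q u). c < x)"
    using assms by (intro ball_cong) (fastforce dest: set_zip_leftD)+
  show ?thesis
  proof (cases "length q = length u")
    case True
    show ?thesis unfolding order_match_Cons eq ball_snd_zip[OF True] ..
  next
    case False
    thus ?thesis by (simp add: order_match_def)
  qed
qed

section \<open>Occurrences as factorizations of the word\<close>

lemma occurrence_iff:
  "occurrence p w j \<longleftrightarrow>
     strict_mono_on {..<length (letters p)} j \<and> (\<forall>s<length (letters p). j s < length w) \<and>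
     order_match (letters p) (map (\<lambda>s. w ! j s) [0..<length (letters p)]) \<and>
     (\<forall>s. Suc s < length (letters p) \<and> s \<notin> dashes p \<longrightarrow> j (Suc s) = j s + 1)"
  by (auto simp: occurrence_def order_match_nth Let_def)

lemma consecutive_positions:
  fixes j :: "nat \<Rightarrow> nat"
  assumes "\<And>s. Suc s < m \<Longrightarrow> j (Suc s) = j s + 1" "s < m"
  shows "j s = j 0 + s"
  using assms(2) by (induction s) (use assms(1) in auto)

lemma factor_at:
  assumes "\<And>s. s < m \<Longrightarrow> j s = i + s" "\<And>s. s < m \<Longrightarrow> j s < length w" "m > 0"
  obtains z where "w = take i w @ map (\<lambda>s. w ! j s) [0..<m] @ z" "i + m \<le> length w"
proof -
  \<comment> \<open>The last matched position is \<open>i + (m - 1)\<close>, a true predecessor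
    because \<open>m > 0\<close>.\<close>
  have le: "i + m \<le> length w" using assms(1,2)[of "m - 1"] assms(3) by simp
  have "map (\<lambda>s. w ! j s) [0..<m] = take m (drop i w)"
    using le assms(1) by (intro nth_equalityI) auto
  hence "w = take i w @ map (\<lambda>s. w ! j s) [0..<m] @ drop (i + m) w"
    by (metis append_take_drop_id drop_drop add.commute)
  with le that show thesis by blast
qed

text \<open>Without dashes the matched positions are consecutive, so an occurrence is a factor
  \<open>u\<close>, and its starting position \<open>length x\<close> determines it.\<close>

lemma avoids_contiguous_iff:
  assumes "wf_pattern p" "contiguous p"
  shows "avoids w p \<longleftrightarrow> \<not> (\<exists>x u z. w = x @ u @ z \<and> order_match (letters p) u)"
proof -
  let ?m = "length (letters p)"
  have m: "?m > 0" using assms(1) by (simp add: wf_pattern_def)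
  have "\<exists>x u z. w = x @ u @ z \<and> order_match (letters p) u" if "occurrence p w j" for j
  proof -
    have j: "j s = j 0 + s" if "s < ?m" for s
      by (rule consecutive_positions[OF _ that])
         (use \<open>occurrence p w j\<close> assms(2) in \<open>auto simp: occurrence_iff contiguous_def\<close>)
    show ?thesis
      using factor_at[OF j _ m, of w] \<open>occurrence p w j\<close> by (metis occurrence_iff)
  qed
  moreover have "\<exists>j. occurrence p w j" if "w = x @ u @ z" "order_match (letters p) u" for x u z
  proof
    have "length u = ?m" using that(2) by (simp add: order_match_def)
    moreover from this have "map (\<lambda>s. w ! (length x + s)) [0..<?m] = u"
      using that(1) by (intro nth_equalityI) (auto simp: nth_append)
    ultimately show "occurrence p w (\<lambda>s. length x + s)"
      using that by (auto simp: occurrence_iff strict_mono_on_def)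
  qed
  ultimately show ?thesis unfolding avoids_def by blast
qed

text \<open>The only dash leaves a gap \<open>y\<close>, possibly empty, between the letter
  \<open>c\<close> matched with \<open>k\<close> and the factor \<open>u\<close> matched with
  \<open>p\<close>.\<close>

lemma avoids_letter_dash_iff:
  assumes "wf_pattern p" "contiguous p"
  shows "avoids w (letter_dash k p) \<longleftrightarrow>
    \<not> (\<exists>x c y u z. w = x @ c # y @ u @ z \<and> order_match (k # letters p) (c # u))"
proof -
  let ?m = "length (letters p)"
  have m: "?m > 0" using assms(1) by (simp add: wf_pattern_def)
  \<comment> \<open>Index 0 is peeled off at the front, as it belongs to the new letter
    \<open>k\<close>; \<open>upt_Suc\<close> would peel off the last index.\<close>
  have map_eq: "map f [0..<Suc ?m] = f 0 # map (\<lambda>s. f (Suc s)) [0..<?m]" for f :: "nat \<Rightarrow> nat"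
    by (simp add: upt_conv_Cons map_Suc_upt[symmetric] del: upt_Suc)
  have "\<exists>x c y u z. w = x @ c # y @ u @ z \<and> order_match (k # letters p) (c # u)"
    if occ: "occurrence (letter_dash k p) w j" for j
  proof -
    have j: "j (Suc s) = j (Suc 0) + s" if "s < ?m" for s
      by (rule consecutive_positions[where j = "\<lambda>s. j (Suc s)", OF _ that])
         (use occ assms(2) in \<open>auto simp: occurrence_iff contiguous_def letter_dash_def\<close>)
    have "j (Suc s) < length w" if "s < ?m" for s
      using occ that by (auto simp: occurrence_iff letter_dash_def)
    from factor_at[OF j this m] obtain z where
      w: "w = take (j (Suc 0)) w @ map (\<lambda>s. w ! j (Suc s)) [0..<?m] @ z"
      and le: "j (Suc 0) + ?m \<le> length w" by blast
    \<comment> \<open>The letter matched with \<open>k\<close> lies strictly before the factor, so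
      the prefix ending at the factor can be cut at that letter.\<close>
    have "j 0 < j (Suc 0)"
      using occ m by (auto simp: occurrence_iff letter_dash_def strict_mono_on_def)
    hence "take (j (Suc 0)) w =
        take (j 0) (take (j (Suc 0)) w) @ w ! j 0 # drop (Suc (j 0)) (take (j (Suc 0)) w)"
      using le by (subst id_take_nth_drop[of "j 0"]) auto
    with w have "w = take (j 0) (take (j (Suc 0)) w) @ w ! j 0 #
        drop (Suc (j 0)) (take (j (Suc 0)) w) @ map (\<lambda>s. w ! j (Suc s)) [0..<?m] @ z"
      by (metis append.assoc append_Cons)
    moreover have "order_match (k # letters p) (w ! j 0 # map (\<lambda>s. w ! j (Suc s)) [0..<?m])"
      using occ by (simp add: occurrence_iff letter_dash_def map_eq del: upt_Suc)
    ultimately show ?thesis by blast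
  qed
  moreover have "\<exists>j. occurrence (letter_dash k p) w j"
    if w: "w = x @ c # y @ u @ z" and om: "order_match (k # letters p) (c # u)" for x c y u z
  proof
    \<comment> \<open>The factor \<open>u\<close> starts after \<open>x\<close>, the letter
      \<open>c\<close> and \<open>y\<close>, which accounts for the \<open>Suc\<close>.\<close>
    define j where
      "j s = (case s of 0 \<Rightarrow> length x | Suc t \<Rightarrow> Suc (length x + length y + t))" for s
    have len: "length u = ?m" using om by (simp add: order_match_def)
    hence "map (\<lambda>s. w ! j s) [0..<Suc ?m] = c # u"
      unfolding map_eq using w by (auto intro!: nth_equalityI simp: j_def nth_append)
    thus "occurrence (letter_dash k p) w j"
      using om len w
      by (auto simp: occurrence_iff letter_dash_def strict_mono_on_def j_def
            simp del: upt_Suc split: nat.splits)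
  qed
  ultimately show ?thesis unfolding avoids_def by blast
qed

lemma avoids_dash_letter_iff:
  assumes "wf_pattern p" "contiguous p"
  shows "avoids w (dash_letter p k) \<longleftrightarrow>
    \<not> (\<exists>x u y c z. w = x @ u @ y @ c # z \<and> order_match (letters p @ [k]) (u @ [c]))"
proof -
  let ?m = "length (letters p)"
  have m: "?m > 0" using assms(1) by (simp add: wf_pattern_def)
  have "\<exists>x u y c z. w = x @ u @ y @ c # z \<and> order_match (letters p @ [k]) (u @ [c])"
    if occ: "occurrence (dash_letter p k) w j" for j
  proof -
    have j: "j s = j 0 + s" if "s < ?m" for s
      by (rule consecutive_positions[OF _ that])
         (use occ assms(2) in \<open>auto simp: occurrence_iff contiguous_def dash_letter_def\<close>)
    have "j s < length w" if "s < ?m" for s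
      using occ that by (auto simp: occurrence_iff dash_letter_def)
    from factor_at[OF j this m] obtain z where
      w: "w = take (j 0) w @ map (\<lambda>s. w ! j s) [0..<?m] @ z"
      and le: "j 0 + ?m \<le> length w" by blast
    \<comment> \<open>The factor ends at \<open>j (?m - 1)\<close>, so the letter matched with
      \<open>k\<close> falls into the remainder \<open>z\<close>.\<close>
    have "j (?m - 1) < j ?m"
      using occ m by (auto simp: occurrence_iff dash_letter_def strict_mono_on_def)
    hence ge: "j 0 + ?m \<le> j ?m" using j[of "?m - 1"] m by simp
    have lt: "j ?m < length w" using occ by (auto simp: occurrence_iff dash_letter_def)
    \<comment> \<open>\<open>i\<close> is the index of that letter inside \<open>z\<close>; the gap
      \<open>y\<close> will be \<open>take i z\<close>.\<close>
    obtain i where i_eq: "j ?m = j 0 + ?m + i" using le_Suc_ex[OF ge] by blast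
    have "length w = j 0 + ?m + length z" using arg_cong[OF w, of length] le by simp
    hence i: "i < length z" using lt by (simp add: i_eq)
    have "w ! j ?m = (take (j 0) w @ map (\<lambda>s. w ! j s) [0..<?m] @ z) ! j ?m"
      by (rule arg_cong[OF w])
    also have "\<dots> = z ! i" using le by (simp add: nth_append i_eq)
    finally have "z = take i z @ w ! j ?m # drop (Suc i) z"
      using i by (simp add: id_take_nth_drop)
    with w have "w = take (j 0) w @ map (\<lambda>s. w ! j s) [0..<?m] @
        take i z @ w ! j ?m # drop (Suc i) z" by metis
    moreover have "order_match (letters p @ [k]) (map (\<lambda>s. w ! j s) [0..<?m] @ [w ! j ?m])"
      using occ by (simp add: occurrence_iff dash_letter_def)
    ultimately show ?thesis by blast
  qed
  moreover have "\<exists>j. occurrence (dash_letter p k) w j"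
    if w: "w = x @ u @ y @ c # z" and om: "order_match (letters p @ [k]) (u @ [c])" for x u y c z
  proof
    define j where "j s = (if s < ?m then length x + s else length x + length u + length y)" for s
    have len: "length u = ?m" using om by (simp add: order_match_def)
    hence "map (\<lambda>s. w ! j s) [0..<?m] = u" "w ! j ?m = c"
      using w by (auto intro!: nth_equalityI simp: j_def nth_append)
    thus "occurrence (dash_letter p k) w j"
      using om len w
      by (auto simp: occurrence_iff dash_letter_def strict_mono_on_def j_def)
  qed
  ultimately show ?thesis unfolding avoids_def by blast
qed

section \<open>Splitting a word at an extremal letter\<close>

text \<open>No letter is \<open>R\<close>-related to \<open>e\<close>, so \<open>u\<close> misses
  \<open>e\<close> and lies on one side of it. If \<open>u\<close> lies in \<open>l\<close>, so does
  the earlier letter \<open>c\<close>; if it lies in \<open>r\<close>, the letter \<open>e\<close>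
  can replace \<open>c\<close>. Keeping \<open>R\<close> abstract covers both the maximum and the
  minimum.\<close>

lemma letter_then_factor_split_iff:
  assumes "\<And>d. d \<in> set r \<Longrightarrow> R e d" "\<And>c. c \<in> set (l @ e # r) \<Longrightarrow> \<not> R c e"
  shows "(\<exists>x c y u z. l @ e # r = x @ c # y @ u @ z \<and> P u \<and> (\<forall>d\<in>set u. R c d)) \<longleftrightarrow>
    (\<exists>x c y u z. l = x @ c # y @ u @ z \<and> P u \<and> (\<forall>d\<in>set u. R c d)) \<or>
    (\<exists>x u z. r = x @ u @ z \<and> P u)" (is "?W \<longleftrightarrow> ?L \<or> ?R")
proof
  assume ?W
  then obtain x c y u z where w: "l @ e # r = (x @ c # y) @ u @ z" and P: "P u"
    and R: "\<forall>d\<in>set u. R c d" by fastforce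
  have "c \<in> set (l @ e # r)" unfolding w by simp
  hence notin: "e \<notin> set u" using assms(2) R by blast
  \<comment> \<open>The cases compare the start of \<open>u\<close> with the end of
    \<open>l\<close>.\<close>
  from w consider v where "l = (x @ c # y) @ v" "v @ e # r = u @ z"
    | v where "x @ c # y = l @ v" "e # r = v @ u @ z"
    using append_eq_append_conv2[THEN iffD1, OF w] by metis
  thus "?L \<or> ?R"
  proof cases
    case 1
    \<comment> \<open>A prefix of \<open>v @ e # r\<close> that extended beyond \<open>v\<close>
      would contain \<open>e\<close>.\<close>
    have "\<exists>t. v = u @ t"
      using 1(2) notin by (auto simp: append_eq_append_conv2 Cons_eq_append_conv)
    then obtain t where "v = u @ t" ..
    hence "l = x @ c # y @ u @ t" using 1(1) by simp
    thus ?thesis using P R by blast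
  next
    case 2
    \<comment> \<open>If \<open>v\<close> is empty, then so is \<open>u\<close>, since it would
      otherwise begin with \<open>e\<close>; the empty word is a factor of \<open>r\<close>.
      Otherwise \<open>v\<close> begins with \<open>e\<close> and \<open>u\<close> lies in
      \<open>r\<close>.\<close>
    hence "\<exists>x z. r = x @ u @ z"
      using notin by (fastforce simp: Cons_eq_append_conv)
    thus ?thesis using P by blast
  qed
next
  assume "?L \<or> ?R"
  thus ?W
  proof
    assume ?L
    then obtain x c y u z where *: "l = x @ c # y @ u @ z" "P u" "\<forall>d\<in>set u. R c d" by blast
    hence "l @ e # r = x @ c # y @ u @ (z @ e # r)" by simp
    with * show ?W by blast
  next
    assume ?R
    then obtain x u z where "r = x @ u @ z" "P u" by blast
    moreover from this have "\<forall>d\<in>set u. R e d" using assms(1) by auto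
    \<comment> \<open>The witnesses are \<open>l\<close> as prefix, \<open>e\<close> as the letter
      \<open>c\<close>, and \<open>x\<close> as the gap.\<close>
    ultimately show ?W by blast
  qed
qed

text \<open>Reversing the word reduces this to the previous splitting: \<open>l\<close> and
  \<open>r\<close> trade places, and \<open>P\<close> becomes \<open>\<lambda>u. P (rev u)\<close>,
  which is allowed because \<open>P\<close> is arbitrary there.\<close>

lemma factor_then_letter_split_iff:
  assumes "\<And>d. d \<in> set l \<Longrightarrow> R e d" "\<And>c. c \<in> set (l @ e # r) \<Longrightarrow> \<not> R c e"
  shows "(\<exists>x u y c z. l @ e # r = x @ u @ y @ c # z \<and> P u \<and> (\<forall>d\<in>set u. R c d)) \<longleftrightarrow>
    (\<exists>x u z. l = x @ u @ z \<and> P u) \<or>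
    (\<exists>x u y c z. r = x @ u @ y @ c # z \<and> P u \<and> (\<forall>d\<in>set u. R c d))"
proof -
  have mirror: "(\<exists>x u y c z. w = x @ u @ y @ c # z \<and> P u \<and> (\<forall>d\<in>set u. R c d)) \<longleftrightarrow>
    (\<exists>x c y u z. rev w = x @ c # y @ u @ z \<and> P (rev u) \<and> (\<forall>d\<in>set u. R c d))" for w
  proof (intro iffI; elim exE conjE)
    fix x u y c z assume "w = x @ u @ y @ c # z" "P u" "\<forall>d\<in>set u. R c d"
    thus "\<exists>x c y u z. rev w = x @ c # y @ u @ z \<and> P (rev u) \<and> (\<forall>d\<in>set u. R c d)"
      by (intro exI[of _ "rev z"] exI[of _ c] exI[of _ "rev y"] exI[of _ "rev u"]
            exI[of _ "rev x"]) simp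
  next
    fix x c y u z assume "rev w = x @ c # y @ u @ z" "P (rev u)" "\<forall>d\<in>set u. R c d"
    thus "\<exists>x u y c z. w = x @ u @ y @ c # z \<and> P u \<and> (\<forall>d\<in>set u. R c d)"
      by (intro exI[of _ "rev z"] exI[of _ "rev u"] exI[of _ "rev y"] exI[of _ c]
            exI[of _ "rev x"]) (simp add: rev_swap)
  qed
  have factor: "(\<exists>x u z. l = x @ u @ z \<and> P u) \<longleftrightarrow> (\<exists>x u z. rev l = x @ u @ z \<and> P (rev u))"
    by (metis append.assoc rev_append rev_rev_ident)
  have rev: "rev (l @ e # r) = rev r @ e # rev l" by simp
  have "\<And>d. d \<in> set (rev l) \<Longrightarrow> R e d" "\<And>c. c \<in> set (rev r @ e # rev l) \<Longrightarrow> \<not> R c e"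
    using assms by auto
  note split = letter_then_factor_split_iff[where R = R and P = "\<lambda>u. P (rev u)", OF this]
  show ?thesis
    unfolding mirror[of "l @ e # r"] mirror[of r] factor rev by (rule trans[OF split disj_commute])
qed

text \<open>The third assumption isolates the effect of \<open>k\<close>: its letter must be
  \<open>R\<close>-related to the whole factor. Negating the splitting equivalence for occurrences
  then gives the claim.\<close>

lemma avoids_letter_dash_split_iff:
  assumes "wf_pattern p" "contiguous p"
    and "\<And>c u. order_match (k # letters p) (c # u) \<longleftrightarrow>
           order_match (letters p) u \<and> (\<forall>d\<in>set u. R c d)"
    and "\<And>d. d \<in> set r \<Longrightarrow> R e d" "\<And>c. c \<in> set (l @ e # r) \<Longrightarrow> \<not> R c e"
  shows "avoids (l @ e # r) (letter_dash k p) \<longleftrightarrow> avoids l (letter_dash k p) \<and> avoids r p"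
  using letter_then_factor_split_iff[where R = R and P = "order_match (letters p)", OF assms(4,5)]
  by (simp add: avoids_letter_dash_iff avoids_contiguous_iff assms(1-3))

text \<open>The assumption on \<open>k # letters p\<close> serves here too, since
  \<open>order_match_snoc_iff\<close> moves the final letter to the front.\<close>

lemma avoids_dash_letter_split_iff:
  assumes "wf_pattern p" "contiguous p"
    and "\<And>c u. order_match (k # letters p) (c # u) \<longleftrightarrow>
           order_match (letters p) u \<and> (\<forall>d\<in>set u. R c d)"
    and "\<And>d. d \<in> set l \<Longrightarrow> R e d" "\<And>c. c \<in> set (l @ e # r) \<Longrightarrow> \<not> R c e"
  shows "avoids (l @ e # r) (dash_letter p k) \<longleftrightarrow> avoids l p \<and> avoids r (dash_letter p k)"
  using factor_then_letter_split_iff[where R = R and P = "order_match (letters p)", OF assms(4,5)]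
  by (simp add: avoids_dash_letter_iff avoids_contiguous_iff order_match_snoc_iff assms(1-3))

theorem corollary9:
  fixes \<sigma> :: "'i \<Rightarrow> pattern" and I :: "'i set" and k :: "'i \<Rightarrow> nat"
    and n :: nat and \<pi> \<pi>l \<pi>r \<pi>l' \<pi>r' :: "nat list"
  assumes "\<forall>i\<in>I. wf_pattern (\<sigma> i) \<and> contiguous (\<sigma> i)"
    and "n \<ge> 1"
    and "\<pi> \<in> permutations_of_set {1..n}"
    and "\<pi> = \<pi>l @ n # \<pi>r"
    and "\<pi> = \<pi>l' @ 1 # \<pi>r'"
  shows "((\<forall>i\<in>I. \<forall>a\<in>set (letters (\<sigma> i)). a < k i) \<longrightarrow>
            ((\<forall>i\<in>I. avoids \<pi> (letter_dash (k i) (\<sigma> i))) \<longleftrightarrow>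
               (\<forall>i\<in>I. avoids \<pi>l (letter_dash (k i) (\<sigma> i))) \<and> (\<forall>i\<in>I. avoids \<pi>r (\<sigma> i)))
          \<and> ((\<forall>i\<in>I. avoids \<pi> (dash_letter (\<sigma> i) (k i))) \<longleftrightarrow>
               (\<forall>i\<in>I. avoids \<pi>l (\<sigma> i)) \<and> (\<forall>i\<in>I. avoids \<pi>r (dash_letter (\<sigma> i) (k i)))))
       \<and> ((\<forall>i\<in>I. \<forall>a\<in>set (letters (\<sigma> i)). a > 1) \<longrightarrow>
            ((\<forall>i\<in>I. avoids \<pi> (letter_dash 1 (\<sigma> i))) \<longleftrightarrow>
               (\<forall>i\<in>I. avoids \<pi>l' (letter_dash 1 (\<sigma> i))) \<and> (\<forall>i\<in>I. avoids \<pi>r' (\<sigma> i)))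
          \<and> ((\<forall>i\<in>I. avoids \<pi> (dash_letter (\<sigma> i) 1)) \<longleftrightarrow>
               (\<forall>i\<in>I. avoids \<pi>l' (\<sigma> i)) \<and> (\<forall>i\<in>I. avoids \<pi>r' (dash_letter (\<sigma> i) 1))))"
proof -
  have dist: "distinct \<pi>" and set: "set \<pi> = {1..n}"
    using assms(3) by (auto dest: permutations_of_setD)
  have max: "d < n" if "d \<in> set \<pi>l \<union> set \<pi>r" for d
  proof -
    \<comment> \<open>Distinctness lets \<open>n\<close> occur only at the cut.\<close>
    have "d \<in> set \<pi>" "d \<noteq> n" using that dist unfolding assms(4) by auto
    thus ?thesis using set by auto
  qed
  have max': "\<not> n < c" if "c \<in> set (\<pi>l @ n # \<pi>r)" for c
    using that set assms(4) by (metis atLeastAtMost_iff leD)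
  have min: "1 < d" if "d \<in> set \<pi>l' \<union> set \<pi>r'" for d
  proof -
    have "d \<in> set \<pi>" "d \<noteq> 1" using that dist unfolding assms(5) by auto
    thus ?thesis using set by auto
  qed
  have min': "\<not> c < 1" if "c \<in> set (\<pi>l' @ 1 # \<pi>r')" for c
    using that set assms(5) by (metis atLeastAtMost_iff leD)
  have wf: "wf_pattern (\<sigma> i)" "contiguous (\<sigma> i)" if "i \<in> I" for i
    using assms(1) that by auto
  show ?thesis
  proof (intro conjI impI)
    assume "\<forall>i\<in>I. \<forall>a\<in>set (letters (\<sigma> i)). a < k i"
    hence om: "order_match (k i # letters (\<sigma> i)) (c # u) \<longleftrightarrow>
        order_match (letters (\<sigma> i)) u \<and> (\<forall>d\<in>set u. d < c)" if "i \<in> I" for i c u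
      using that by (simp add: order_match_Cons_greater)
    show "(\<forall>i\<in>I. avoids \<pi> (letter_dash (k i) (\<sigma> i))) \<longleftrightarrow>
        (\<forall>i\<in>I. avoids \<pi>l (letter_dash (k i) (\<sigma> i))) \<and> (\<forall>i\<in>I. avoids \<pi>r (\<sigma> i))"
      \<comment> \<open>\<open>R c d\<close> says that \<open>c\<close> dominates \<open>d\<close>,
        with \<open>n\<close> as the extremal letter; for the cut at 1 the order is
        reversed.\<close>
      using avoids_letter_dash_split_iff[where R = "\<lambda>c d. d < c", OF wf om _ max'] max
      unfolding assms(4) by blast
    show "(\<forall>i\<in>I. avoids \<pi> (dash_letter (\<sigma> i) (k i))) \<longleftrightarrow>
        (\<forall>i\<in>I. avoids \<pi>l (\<sigma> i)) \<and> (\<forall>i\<in>I. avoids \<pi>r (dash_letter (\<sigma> i) (k i)))"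
      using avoids_dash_letter_split_iff[where R = "\<lambda>c d. d < c", OF wf om _ max'] max
      unfolding assms(4) by blast
  next
    assume "\<forall>i\<in>I. \<forall>a\<in>set (letters (\<sigma> i)). a > 1"
    hence om: "order_match (1 # letters (\<sigma> i)) (c # u) \<longleftrightarrow>
        order_match (letters (\<sigma> i)) u \<and> (\<forall>d\<in>set u. c < d)" if "i \<in> I" for i c u
      using that by (simp add: order_match_Cons_less)
    show "(\<forall>i\<in>I. avoids \<pi> (letter_dash 1 (\<sigma> i))) \<longleftrightarrow>
        (\<forall>i\<in>I. avoids \<pi>l' (letter_dash 1 (\<sigma> i))) \<and> (\<forall>i\<in>I. avoids \<pi>r' (\<sigma> i))"
      using avoids_letter_dash_split_iff[where R = "(<)", OF wf om _ min'] min
      unfolding assms(5) by blast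
    show "(\<forall>i\<in>I. avoids \<pi> (dash_letter (\<sigma> i) 1)) \<longleftrightarrow>
        (\<forall>i\<in>I. avoids \<pi>l' (\<sigma> i)) \<and> (\<forall>i\<in>I. avoids \<pi>r' (dash_letter (\<sigma> i) 1))"
      using avoids_dash_letter_split_iff[where R = "(<)", OF wf om _ min'] min
      unfolding assms(5) by blast
  qed
qed

end
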